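(* Consider the system $\mathcal G$ (CT or DT) with $(A,C)$ detectable, a gain $L$ such that $A_{cl}=A-LC$ is Hurwitz (CT) or Schur (DT), and matrices $P\in\mathbb{R}^{m\times n}$ of full column rank $n$ and $Q\in\mathbb{R}^{m\times m}$ with $PA_{cl}=QP$ (and $\mu_\infty(Q)<0$ in CT, $\|Q\|_\infty<1$ in DT). Let $(\underline z_t,\overline z_t)$ be generated by the observer $\hat{\mathcal G}$ from any initial condition with $\underline z_0\le Px_0\le\overline z_0$. Then for all $t\in\mathbb{T}$, all admissible initial states $x_0\in[\underline x_0,\overline x_0]$ and all noise signals with $w_t\in[\underline w,\overline w]$, $v_t\in[\underline v,\overline v]$ for all $t$, the true state satisfies $\underline z_t\le Px_t\le \overline z_t$ and $$x_t\in \hat X^P_t\subseteq \hat X^I_t.$$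
   Context: System $\mathcal G$: $x_t^+ = Ax_t + Bu_t + Ww_t$, $y_t = Cx_t + Du_t + Vv_t$, $t\in\mathbb{T}$, with state $x_t\in\mathbb{R}^n$, output $y_t\in\mathbb{R}^l$, known input $u_t$, process noise $w_t\in[\underline w,\overline w]\subset\mathbb{R}^{n_w}$, measurement noise $v_t\in[\underline v,\overline v]\subset\mathbb{R}^{n_v}$, and unknown initial state $x_0\in[\underline x_0,\overline x_0]$; $u_t,y_t$ and all bounds are known. In continuous time (CT) $x_t^+=\dot x_t$ and $\mathbb{T}=\mathbb{R}_{\ge0}$; in discrete time (DT) $x_t^+=x_{t+1}$ and $\mathbb{T}=\{0,1,2,\dots\}$. Inequalities between vectors are entrywise. Notation: for a matrix $M$, $M^{\oplus}=\max(M,0)$ entrywise, $M^{\ominus}=M^{\oplus}-M$, $|M|=M^\oplus+M^\ominus$; for square $M$, $M^{\mathrm d}$ is its diagonal part and $M^{\mathrm{nd}}=M-M^{\mathrm d}$. Logarithmic norm $\mu_\infty(M)=\max_i(M_{ii}+\sum_{j\neq i}|M_{ij}|)$, induced norm $\|M\|_\infty=\max_i\sum_j|M_{ij}|$. Observer $\hat{\mathcal G}$: in CT set $Q^\uparrow = Q^{\mathrm d}+(Q^{\mathrm{nd}})^{\oplus}$, $Q^\downarrow=(Q^{\mathrm{nd}})^{\ominus}$ and $z^+=\dot z$; in DT set $Q^\uparrow=Q^\oplus$, $Q^\downarrow=Q^\ominus$ and $z_t^+=z_{t+1}$. Then $\underline z_t^+ = Q^\uparrow\underline z_t - Q^\downarrow\overline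 z_t + (PW)^\oplus\underline w - (PW)^\ominus\overline w + (PLV)^\ominus\underline v - (PLV)^\oplus\overline v + PLy_t + P(B-LD)u_t$, $\overline z_t^+ = Q^\uparrow\overline z_t - Q^\downarrow\underline z_t + (PW)^\oplus\overline w - (PW)^\ominus\underline w + (PLV)^\ominus\overline v - (PLV)^\oplus\underline v + PLy_t + P(B-LD)u_t$. Polytopic estimate: $\hat X^P_t=\{x\in\mathbb{R}^n:\ \underline z_t\le Px\le\overline z_t,\ \underline c_t\le Cx\le\overline c_t\}$ where $\underline c_t = y_t-Du_t-V^\oplus\overline v+V^\ominus\underline v$ and $\overline c_t = y_t-Du_t-V^\oplus\underline v+V^\ominus\overline v$. Interval estimate: let $\tilde P=\begin{bmatrix}P\\ C\end{bmatrix}$ (full column rank) with Moore–Penrose pseudoinverse $\tilde P^\dagger$ (so $\tilde P^\dagger\tilde P=I$), $\underline\zeta_t=\begin{bmatrix}\underline z_t\\ \underline c_t\end{bmatrix}$, $\overline\zeta_t=\begin{bmatrix}\overline z_t\\ \overline c_t\end{bmatrix}$, $\overline x_t=(\tilde P^\dagger)^\oplus\overline\zeta_t-(\tilde P^\dagger)^\ominus\underline\zeta_t$, $\underline x_t=(\tilde P^\dagger)^\oplus\underline\zeta_t-(\tilde P^\dagger)^\ominus\overline\zeta_t$, and $\hat X^I_t=\{x:\underline x_t\le x\le\overline x_t\}$. *)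

theory Defs
  imports "HOL-Analysis.Analysis"
begin

(* Time domain: continuous time (CT) or discrete time (DT). Time is real-valued;
   in DT the time set is {0,1,2,...} embedded in the reals. *)
datatype time_domain = CT | DT

definition time_set :: "time_domain \<Rightarrow> real set" where
  "time_set td = (case td of CT \<Rightarrow> {0..} | DT \<Rightarrow> range real)"

(* x_t^+ = f t : derivative (CT, one-sided at 0) or next value (DT) *)
definition evolves :: "time_domain \<Rightarrow> (real \<Rightarrow> 'a::real_normed_vector) \<Rightarrow> (real \<Rightarrow> 'a) \<Rightarrow> bool" where
  "evolves td x f = (case td of
      CT \<Rightarrow> (\<forall>t\<ge>0. (x has_vector_derivative f t) (at t within {0..}))
    | DT \<Rightarrow> (\<forall>k::nat. x (real k + 1) = f (real k)))"

(* entrywise positive / negative parts, diagonal and off-diagonal parts *)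
definition mpos :: "real^'n^'m \<Rightarrow> real^'n^'m" where
  "mpos M = (\<chi> i j. max (M$i$j) 0)"

definition mneg :: "real^'n^'m \<Rightarrow> real^'n^'m" where
  "mneg M = mpos M - M"

definition mdiag :: "real^'n^'n \<Rightarrow> real^'n^'n" where
  "mdiag M = (\<chi> i j. if i = j then M$i$j else 0)"

definition mnd :: "real^'n^'n \<Rightarrow> real^'n^'n" where
  "mnd M = M - mdiag M"

definition Qup :: "time_domain \<Rightarrow> real^'m^'m \<Rightarrow> real^'m^'m" where
  "Qup td Q = (case td of CT \<Rightarrow> mdiag Q + mpos (mnd Q) | DT \<Rightarrow> mpos Q)"

definition Qdown :: "time_domain \<Rightarrow> real^'m^'m \<Rightarrow> real^'m^'m" where
  "Qdown td Q = (case td of CT \<Rightarrow> mneg (mnd Q) | DT \<Rightarrow> mneg Q)"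

(* logarithmic infinity norm and induced infinity norm *)
definition mu_inf :: "real^'n^'n \<Rightarrow> real" where
  "mu_inf M = Max (range (\<lambda>i. M$i$i + (\<Sum>j\<in>UNIV - {i}. \<bar>M$i$j\<bar>)))"

definition norm_inf :: "real^'n^'m \<Rightarrow> real" where
  "norm_inf M = Max (range (\<lambda>i. \<Sum>j\<in>UNIV. \<bar>M$i$j\<bar>))"

definition contractive :: "time_domain \<Rightarrow> real^'m^'m \<Rightarrow> bool" where
  "contractive td Q = (case td of CT \<Rightarrow> mu_inf Q < 0 | DT \<Rightarrow> norm_inf Q < 1)"

(* complex eigenvalues of a real matrix *)
definition cmat :: "real^'n^'m \<Rightarrow> complex^'n^'m" where
  "cmat M = (\<chi> i j. complex_of_real (M$i$j))"

definition is_eigenpair :: "real^'n^'n \<Rightarrow> complex \<Rightarrow> complex^'n \<Rightarrow> bool" where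
  "is_eigenpair A e v = (v \<noteq> 0 \<and> cmat A *v v = e *s v)"

(* eigenvalue in the closed unstable region *)
definition unstable_eig :: "time_domain \<Rightarrow> complex \<Rightarrow> bool" where
  "unstable_eig td e = (case td of CT \<Rightarrow> Re e \<ge> 0 | DT \<Rightarrow> cmod e \<ge> 1)"

(* Hurwitz (CT) / Schur (DT) *)
definition stable_mat :: "time_domain \<Rightarrow> real^'n^'n \<Rightarrow> bool" where
  "stable_mat td A = (\<forall>e v. is_eigenpair A e v \<longrightarrow> \<not> unstable_eig td e)"

(* detectability of (A,C), PBH test *)
definition detectable :: "time_domain \<Rightarrow> real^'n^'n \<Rightarrow> real^'n^'l \<Rightarrow> bool" where
  "detectable td A C = (\<forall>e v. is_eigenpair A e v \<and> unstable_eig td e \<longrightarrow> cmat C *v v \<noteq> 0)"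

(* Moore-Penrose pseudoinverse *)
definition pinv :: "real^'n^'m \<Rightarrow> real^'m^'n" where
  "pinv M = (THE X. M ** X ** M = M \<and> X ** M ** X = X \<and>
                    transpose (M ** X) = M ** X \<and> transpose (X ** M) = X ** M)"

(* stacking [P; C] and [a; b] *)
definition vstack :: "real^'n^'m \<Rightarrow> real^'n^'l \<Rightarrow> real^'n^('m + 'l)" where
  "vstack P C = (\<chi> k. case k of Inl i \<Rightarrow> P$i | Inr j \<Rightarrow> C$j)"

definition vcat :: "real^'m \<Rightarrow> real^'l \<Rightarrow> real^('m + 'l)" where
  "vcat a b = (\<chi> k. case k of Inl i \<Rightarrow> a$i | Inr j \<Rightarrow> b$j)"

(* measurement-derived bounds on C x_t *)
definition c_lo :: "real^'n^'l \<Rightarrow> real^'p^'l \<Rightarrow> real^'v^'l \<Rightarrow> real^'v \<Rightarrow> real^'v \<Rightarrow> real^'l \<Rightarrow> real^'p \<Rightarrow> real^'l" where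
  "c_lo C D V v_lo v_hi y u = y - D *v u - mpos V *v v_hi + mneg V *v v_lo"

definition c_hi :: "real^'n^'l \<Rightarrow> real^'p^'l \<Rightarrow> real^'v^'l \<Rightarrow> real^'v \<Rightarrow> real^'v \<Rightarrow> real^'l \<Rightarrow> real^'p \<Rightarrow> real^'l" where
  "c_hi C D V v_lo v_hi y u = y - D *v u - mpos V *v v_lo + mneg V *v v_hi"

(* polytopic estimate X^P *)
definition XP :: "real^'n^'m \<Rightarrow> real^'n^'l \<Rightarrow> real^'m \<Rightarrow> real^'m \<Rightarrow> real^'l \<Rightarrow> real^'l \<Rightarrow> (real^'n) set" where
  "XP P C zl zh cl ch = {x. zl \<le> P *v x \<and> P *v x \<le> zh \<and> cl \<le> C *v x \<and> C *v x \<le> ch}"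

(* interval estimate X^I *)
definition XI :: "real^'n^'m \<Rightarrow> real^'n^'l \<Rightarrow> real^'m \<Rightarrow> real^'m \<Rightarrow> real^'l \<Rightarrow> real^'l \<Rightarrow> (real^'n) set" where
  "XI P C zl zh cl ch =
     (let Pt = pinv (vstack P C); zeta_lo = vcat zl cl; zeta_hi = vcat zh ch;
          x_hi = mpos Pt *v zeta_hi - mneg Pt *v zeta_lo;
          x_lo = mpos Pt *v zeta_lo - mneg Pt *v zeta_hi
      in {x. x_lo \<le> x \<and> x \<le> x_hi})"

end

theory Submission
  imports Defs
begin

(* With e_lo = P x - z_lo and e_hi = z_hi - P x, the identity P A = Q P + P L C turns the
   observer into the error system
     (e_lo, e_hi)^+ = [[Q_up, Q_down], [Q_down, Q_up]] (e_lo, e_hi) + r,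
   where r >= 0 collects the gaps between the noise terms P W w, P L V v and their interval
   enclosures.  The block matrix is Metzler in CT and entrywise nonnegative in DT, so the
   nonnegative orthant is forward invariant (by induction in DT, by a first-exit-time argument
   in CT), which gives z_lo <= P x <= z_hi.  The measurement equation bounds C x, and
   X^P is contained in X^I because [P; C]^+ [P; C] = I. *)

definition nonneg_matrix :: "real^'n^'m \<Rightarrow> bool" where
  "nonneg_matrix M \<longleftrightarrow> (\<forall>i j. 0 \<le> M$i$j)"

definition interval_lower :: "real^'n^'m \<Rightarrow> real^'n \<Rightarrow> real^'n \<Rightarrow> real^'m" where
  "interval_lower M lo hi = mpos M *v lo - mneg M *v hi"

definition interval_upper :: "real^'n^'m \<Rightarrow> real^'n \<Rightarrow> real^'n \<Rightarrow> real^'m" where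
  "interval_upper M lo hi = mpos M *v hi - mneg M *v lo"

lemma nonneg_matrix_mpos: "nonneg_matrix (mpos M)"
  by (simp add: nonneg_matrix_def mpos_def)

lemma nonneg_matrix_mneg: "nonneg_matrix (mneg M)"
  by (simp add: nonneg_matrix_def mneg_def mpos_def)

lemma mpos_minus_mneg: "mpos M - mneg M = M"
  by (simp add: mneg_def)

lemma nonneg_matrix_mult_mono:
  assumes "nonneg_matrix M" "a \<le> b"
  shows "M *v a \<le> M *v b"
  using assms unfolding nonneg_matrix_def less_eq_vec_def matrix_vector_mult_def
  by (auto intro!: sum_mono mult_left_mono)

lemma interval_lower_le:
  assumes "lo \<le> z" "z \<le> hi"
  shows "interval_lower M lo hi \<le> M *v z"
proof -
  have "mpos M *v lo \<le> mpos M *v z" "mneg M *v z \<le> mneg M *v hi"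
    using assms by (simp_all add: nonneg_matrix_mult_mono nonneg_matrix_mpos nonneg_matrix_mneg)
  then have "interval_lower M lo hi \<le> mpos M *v z - mneg M *v z"
    unfolding interval_lower_def by (rule diff_mono)
  then show ?thesis
    by (simp add: mpos_minus_mneg flip: matrix_vector_mult_diff_rdistrib)
qed

lemma le_interval_upper:
  assumes "lo \<le> z" "z \<le> hi"
  shows "M *v z \<le> interval_upper M lo hi"
proof -
  have "mpos M *v z \<le> mpos M *v hi" "mneg M *v lo \<le> mneg M *v z"
    using assms by (simp_all add: nonneg_matrix_mult_mono nonneg_matrix_mpos nonneg_matrix_mneg)
  then have "mpos M *v z - mneg M *v z \<le> interval_upper M lo hi"
    unfolding interval_upper_def by (rule diff_mono)
  then show ?thesis
    by (simp add: mpos_minus_mneg flip: matrix_vector_mult_diff_rdistrib)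
qed

lemma interval_gaps_nonneg:
  assumes "lo \<le> z" "z \<le> hi"
  shows "0 \<le> M *v z - interval_lower M lo hi" "0 \<le> interval_upper M lo hi - M *v z"
  using interval_lower_le[OF assms] le_interval_upper[OF assms] by simp_all

lemma measurement_bounds:
  assumes "v_lo \<le> v" "v \<le> v_hi"
  shows "c_lo C D V v_lo v_hi (C *v x + D *v u + V *v v) u \<le> C *v x"
    and "C *v x \<le> c_hi C D V v_lo v_hi (C *v x + D *v u + V *v v) u"
  using le_interval_upper[OF assms, of V] interval_lower_le[OF assms, of V]
  by (simp_all add: c_lo_def c_hi_def interval_lower_def interval_upper_def algebra_simps)

lemma pinv_eq_gram_inverse:
  fixes M :: "real^'n^'k"
  assumes B: "B ** (transpose M ** M) = mat 1"
  shows "pinv M = B ** transpose M"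
proof -
  let ?G = "transpose M ** M"
  have GB: "?G ** B = mat 1"
    using B matrix_left_right_inverse by blast
  have "transpose B ** ?G = mat 1"
    using GB by (metis matrix_transpose_mul transpose_mat transpose_transpose)
  then have B_sym: "transpose B = B"
    by (metis GB matrix_mul_assoc matrix_mul_lid matrix_mul_rid)
  define X where "X = B ** transpose M"
  have XM: "X ** M = mat 1"
    using B by (simp add: X_def matrix_mul_assoc)
  have "M ** X ** M = M \<and> X ** M ** X = X \<and>
        transpose (M ** X) = M ** X \<and> transpose (X ** M) = X ** M"
    using XM by (simp add: X_def matrix_transpose_mul B_sym flip: matrix_mul_assoc)
  moreover have "Y = X" if "M ** Y ** M = M" "transpose (M ** Y) = M ** Y" for Y
  proof -
    have "transpose M = transpose (M ** Y ** M)"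
      using that(1) by simp
    also have "\<dots> = ?G ** Y"
      using that(2) by (simp add: matrix_transpose_mul matrix_mul_assoc)
    finally have "B ** transpose M = (B ** ?G) ** Y"
      by (metis matrix_mul_assoc)
    then show ?thesis
      using B by (simp add: X_def)
  qed
  ultimately show ?thesis
    unfolding pinv_def X_def[symmetric] by (intro the_equality) blast+
qed

lemma pinv_mult_left:
  fixes M :: "real^'n^'k"
  assumes "inj ((*v) M)"
  shows "pinv M ** M = mat 1"
proof -
  have "inj ((*v) (transpose M ** M))"
  proof (rule injI)
    fix a b
    assume "(transpose M ** M) *v a = (transpose M ** M) *v b"
    then have "(M *v (a - b)) \<bullet> (M *v (a - b)) = 0"
      by (metis dot_lmul_matrix matrix_vector_mul_assoc matrix_vector_mult_diff_distrib
          right_minus_eq transpose_transpose vector_transpose_matrix inner_zero_right)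
    then show "a = b"
      using assms by (metis inner_eq_zero_iff injD matrix_vector_mult_0_right right_minus_eq)
  qed
  then obtain B where "B ** (transpose M ** M) = mat 1"
    using matrix_left_invertible_injective by blast
  then show ?thesis
    using matrix_mul_assoc by (metis pinv_eq_gram_inverse)
qed

lemma vstack_mult: "vstack P C *v x = vcat (P *v x) (C *v x)"
  by (simp add: vec_eq_iff vstack_def vcat_def matrix_vector_mult_def split: sum.split)

lemma vcat_le_iff: "vcat a b \<le> vcat c d \<longleftrightarrow> a \<le> c \<and> b \<le> d"
  by (auto simp: less_eq_vec_def vcat_def split: sum.split)

lemma vcat_eq_iff: "vcat a b = vcat c d \<longleftrightarrow> a = c \<and> b = d"
  by (metis order.eq_iff vcat_le_iff)

lemma XP_subset_XI:
  assumes "inj ((*v) P)"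
  shows "XP P C zl zh cl ch \<subseteq> XI P C zl zh cl ch"
proof
  fix x
  assume "x \<in> XP P C zl zh cl ch"
  then have bounds: "vcat zl cl \<le> vstack P C *v x" "vstack P C *v x \<le> vcat zh ch"
    by (auto simp: XP_def vstack_mult vcat_le_iff)
  have "inj ((*v) (vstack P C))"
    using assms by (auto simp: inj_def vstack_mult vcat_eq_iff)
  then have "pinv (vstack P C) *v (vstack P C *v x) = x"
    by (simp add: matrix_vector_mul_assoc pinv_mult_left)
  then show "x \<in> XI P C zl zh cl ch"
    using interval_lower_le[OF bounds, of "pinv (vstack P C)"]
      le_interval_upper[OF bounds, of "pinv (vstack P C)"]
    by (simp add: XI_def Let_def interval_lower_def interval_upper_def)
qed

lemma evolves_cong:
  assumes "evolves td x f" "\<And>t. t \<in> time_set td \<Longrightarrow> f t = g t"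
  shows "evolves td x g"
  using assms by (cases td) (auto simp: evolves_def time_set_def)

lemma evolves_matrix_mult:
  fixes M :: "real^'n^'m"
  assumes "evolves td x f"
  shows "evolves td (\<lambda>t. M *v x t) (\<lambda>t. M *v f t)"
proof (cases td)
  case CT
  have "((\<lambda>t. M *v x t) has_vector_derivative M *v f t) (at t within {0..})" if "0 \<le> t" for t
  proof -
    have "(x has_vector_derivative f t) (at t within {0..})"
      using assms CT that by (simp add: evolves_def)
    then show ?thesis
      by (rule bounded_linear.has_vector_derivative[OF matrix_vector_mul_bounded_linear])
  qed
  then show ?thesis
    using CT by (simp add: evolves_def)
qed (use assms in \<open>simp add: evolves_def\<close>)

lemma evolves_diff:
  assumes "evolves td x f" "evolves td y g"
  shows "evolves td (\<lambda>t. x t - y t) (\<lambda>t. f t - g t)"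
  using assms by (cases td) (auto simp: evolves_def intro!: has_vector_derivative_diff)

lemma bounded_linear_vcat_left: "bounded_linear (\<lambda>a. vcat a 0)"
  by (auto simp: linear_conv_bounded_linear[symmetric] vcat_def vec_eq_iff intro!: linearI
      split: sum.split)

lemma bounded_linear_vcat_right: "bounded_linear (\<lambda>b. vcat 0 b)"
  by (auto simp: linear_conv_bounded_linear[symmetric] vcat_def vec_eq_iff intro!: linearI
      split: sum.split)

lemma vcat_add: "vcat a b + vcat c d = vcat (a + c) (b + d)"
  by (simp add: vcat_def vec_eq_iff split: sum.split)

lemma vcat_nonneg_iff: "0 \<le> vcat a b \<longleftrightarrow> 0 \<le> a \<and> 0 \<le> b"
  by (auto simp: less_eq_vec_def vcat_def split: sum.split)

lemma evolves_vcat: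
  assumes "evolves td a f" "evolves td b g"
  shows "evolves td (\<lambda>t. vcat (a t) (b t)) (\<lambda>t. vcat (f t) (g t))"
proof (cases td)
  case CT
  have "((\<lambda>t. vcat (a t) 0 + vcat 0 (b t)) has_vector_derivative vcat (f t) 0 + vcat 0 (g t))
          (at t within {0..})" if "0 \<le> t" for t
    using assms CT that
    by (auto simp: evolves_def intro!: has_vector_derivative_add
        bounded_linear.has_vector_derivative[OF bounded_linear_vcat_left]
        bounded_linear.has_vector_derivative[OF bounded_linear_vcat_right])
  then show ?thesis
    using CT by (simp add: evolves_def vcat_add)
next
  case DT
  then show ?thesis
    using assms by (simp add: evolves_def)
qed

definition metzler :: "real^'n^'n \<Rightarrow> bool" where
  "metzler M \<longleftrightarrow> (\<forall>i j. i \<noteq> j \<longrightarrow> 0 \<le> M$i$j)"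

definition positive_system_matrix :: "time_domain \<Rightarrow> real^'n^'n \<Rightarrow> bool" where
  "positive_system_matrix td M = (case td of CT \<Rightarrow> metzler M | DT \<Rightarrow> nonneg_matrix M)"

lemma metzler_row_lower_bound:
  assumes "metzler M" "c \<ge> 0" "\<forall>j. -c \<le> e$j" "e$i = -c"
  shows "- ((\<Sum>j\<in>UNIV. \<bar>M$i$j\<bar>) * c) \<le> (M *v e)$i"
proof -
  have "- (\<bar>M$i$j\<bar> * c) \<le> M$i$j * e$j" for j
  proof (cases "i = j")
    case True
    then show ?thesis using assms by (simp add: abs_mult_pos)
  next
    case False
    then have "0 \<le> M$i$j"
      using assms(1) by (simp add: metzler_def)
    then have "M$i$j * (-c) \<le> M$i$j * e$j"
      using assms(3) mult_left_mono[of "-c" "e$j" "M$i$j"] by simp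
    then show ?thesis
      using \<open>0 \<le> M$i$j\<close> by simp
  qed
  then have "(\<Sum>j\<in>UNIV. - (\<bar>M$i$j\<bar> * c)) \<le> (\<Sum>j\<in>UNIV. M$i$j * e$j)"
    by (rule sum_mono)
  then show ?thesis
    by (simp add: matrix_vector_mult_def sum_negf sum_distrib_right)
qed

lemma has_real_derivative_vec_nth:
  "(h has_vector_derivative h') F \<Longrightarrow> ((\<lambda>t. h t $ i) has_real_derivative h' $ i) F"
  unfolding has_real_derivative_iff_has_vector_derivative
  by (rule bounded_linear.has_vector_derivative[OF bounded_linear_vec_nth])

lemma first_hitting_time:
  fixes S :: "real set"
  assumes "closed S" "t \<in> S" "S \<subseteq> {0..}"
  obtains s where "s \<in> S" "\<And>r. 0 \<le> r \<Longrightarrow> r < s \<Longrightarrow> r \<notin> S"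
proof
  have "bdd_below S"
    using assms(3) by (auto simp: bdd_below_def)
  then show "Inf S \<in> S"
    using assms closed_contains_Inf by blast
  show "r \<notin> S" if "r < Inf S" for r
    using cInf_lower[OF _ \<open>bdd_below S\<close>, of r] that by auto
qed

lemma nonneg_at_end_of_positive_interval:
  fixes f :: "real \<Rightarrow> real"
  assumes "continuous_on {0..} f" "0 < s" "\<And>r. 0 \<le> r \<Longrightarrow> r < s \<Longrightarrow> 0 < f r"
  shows "0 \<le> f s"
proof (rule continuous_ge_on_closure[of "{0..<s}" f])
  show "continuous_on (closure {0..<s}) f"
    using assms(1,2) by (auto intro: continuous_on_subset)
  show "s \<in> closure {0..<s}"
    using assms(2) by simp
qed (use assms(3) in \<open>auto intro: less_imp_le\<close>)

lemma first_exit_positive: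
  fixes h :: "real \<Rightarrow> real^'k"
  assumes deriv: "\<And>t. 0 \<le> t \<Longrightarrow> (h has_vector_derivative h' t) (at t within {0..})"
    and exit: "\<And>t i. 0 < t \<Longrightarrow> 0 \<le> h t \<Longrightarrow> h t $ i = 0 \<Longrightarrow> 0 < h' t $ i"
    and init: "\<And>i. 0 < h 0 $ i"
    and "0 \<le> t"
  shows "0 < h t $ i"
proof (rule ccontr)
  assume "\<not> 0 < h t $ i"
  have "continuous_on {0..} h"
    using deriv has_vector_derivative_continuous
    by (meson atLeast_iff continuous_on_eq_continuous_within)
  then have cont: "continuous_on {0..} (\<lambda>t. h t $ j)" for j
    by (intro continuous_intros)
  define S where "S = (\<Union>j. {0..} \<inter> (\<lambda>t. h t $ j) -` {..0})"
  have "closed S"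
    unfolding S_def by (intro closed_UN finite_UNIV ballI continuous_closed_preimage cont) auto
  moreover have "t \<in> S"
    using \<open>\<not> 0 < h t $ i\<close> \<open>0 \<le> t\<close> by (auto simp: S_def not_less)
  ultimately obtain s where "s \<in> S" and before_S: "\<And>r. 0 \<le> r \<Longrightarrow> r < s \<Longrightarrow> r \<notin> S"
    using first_hitting_time[of S t] by (auto simp: S_def)
  then obtain k where s: "0 \<le> s" "h s $ k \<le> 0"
    by (auto simp: S_def)
  have s_pos: "0 < s"
    using s init[of k] by (cases "s = 0") auto
  have before: "0 < h r $ j" if "0 \<le> r" "r < s" for r j
    using before_S[OF that] that by (auto simp: S_def not_le)
  have "0 \<le> h s $ j" for j
    using nonneg_at_end_of_positive_interval[OF cont s_pos before] .
  then have "0 \<le> h s" "h s $ k = 0"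
    using s(2) by (auto simp: less_eq_vec_def intro: order.antisym)
  then have "0 < h' s $ k"
    using exit s_pos by blast
  then obtain d where "0 < d" and d: "\<And>r. 0 < r \<Longrightarrow> s - r \<in> {0..} \<Longrightarrow> r < d \<Longrightarrow> h (s - r) $ k < h s $ k"
    using has_real_derivative_pos_inc_left[OF has_real_derivative_vec_nth[OF deriv[OF s(1)]]]
    by blast
  define r where "r = min (d / 2) s"
  have "h (s - r) $ k < 0"
    using d[of r] \<open>0 < d\<close> s_pos \<open>h s $ k = 0\<close> by (simp add: r_def)
  moreover have "0 < h (s - r) $ k"
    using before[of "s - r" k] \<open>0 < d\<close> s_pos by (simp add: r_def)
  ultimately show False
    by simp
qed

lemma nonneg_invariant_CT:
  fixes e :: "real \<Rightarrow> real^'k"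
  assumes deriv: "\<And>t. 0 \<le> t \<Longrightarrow> (e has_vector_derivative e' t) (at t within {0..})"
    and boundary: "\<And>t i c. 0 \<le> t \<Longrightarrow> 0 \<le> c \<Longrightarrow> (\<forall>j. -c \<le> e t $ j) \<Longrightarrow> e t $ i = -c
                     \<Longrightarrow> - (R * c) \<le> e' t $ i"
    and init: "0 \<le> e 0"
    and "0 \<le> t"
  shows "0 \<le> e t"
proof -
  have eps: "0 \<le> e t $ i + \<epsilon>" if "0 < \<epsilon>" for i \<epsilon>
  proof -
    (* h starts strictly positive and, as l > R, is pushed strictly inwards wherever it
       touches the boundary of the orthant *)
    define l where "l = R + 1"
    define \<delta> where "\<delta> = \<epsilon> / exp (l * t)"
    define h where "h s = e s + (\<delta> * exp (l * s)) *\<^sub>R 1" for s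
    have "\<delta> > 0"
      using that by (simp add: \<delta>_def)
    have h_deriv: "(h has_vector_derivative e' s + (\<delta> * (l * exp (l * s))) *\<^sub>R 1) (at s within {0..})"
      if "0 \<le> s" for s
    proof -
      have "((\<lambda>s. \<delta> * exp (l * s)) has_real_derivative \<delta> * (l * exp (l * s))) (at s within {0..})"
        by (auto intro!: derivative_eq_intros)
      from has_vector_derivative_scaleR[OF this has_vector_derivative_const[of "1::real^'k"]]
      have "((\<lambda>s. (\<delta> * exp (l * s)) *\<^sub>R (1::real^'k)) has_vector_derivative
              (\<delta> * (l * exp (l * s))) *\<^sub>R 1) (at s within {0..})"
        by simp
      then show ?thesis
        unfolding h_def by (rule has_vector_derivative_add[OF deriv[OF that]])
    qed
    have "0 < h t $ i"
    proof (rule first_exit_positive[OF h_deriv _ _ \<open>0 \<le> t\<close>])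
      fix s j
      assume "0 < s" "0 \<le> h s" "h s $ j = 0"
      define c where "c = \<delta> * exp (l * s)"
      have "0 < c"
        using \<open>\<delta> > 0\<close> by (simp add: c_def)
      moreover have "-c \<le> e s $ k" for k
      proof -
        have "0 \<le> h s $ k"
          using \<open>0 \<le> h s\<close> by (simp add: less_eq_vec_def)
        then show ?thesis
          by (simp add: h_def c_def)
      qed
      moreover have "e s $ j = -c"
        using \<open>h s $ j = 0\<close> by (simp add: h_def c_def eq_neg_iff_add_eq_0)
      ultimately have "- (R * c) \<le> e' s $ j"
        using boundary[of s c j] \<open>0 < s\<close> by auto
      moreover have "\<delta> * (l * exp (l * s)) = R * c + c"
        by (simp add: c_def l_def algebra_simps)
      ultimately show "0 < (e' s + (\<delta> * (l * exp (l * s))) *\<^sub>R 1) $ j"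
        using \<open>0 < c\<close> by simp
    next
      show "0 < h 0 $ j" for j
        using init \<open>\<delta> > 0\<close> by (simp add: h_def less_eq_vec_def add_nonneg_pos)
    qed
    then show ?thesis
      by (simp add: h_def \<delta>_def)
  qed
  have "0 \<le> e t $ i" for i
    by (rule field_le_epsilon) (rule eps)
  then show ?thesis
    by (simp add: less_eq_vec_def)
qed

lemma positive_system_nonneg:
  fixes e r :: "real \<Rightarrow> real^'k"
  assumes M: "positive_system_matrix td M"
    and ev: "evolves td e (\<lambda>t. M *v e t + r t)"
    and r: "\<And>t. t \<in> time_set td \<Longrightarrow> 0 \<le> r t"
    and init: "0 \<le> e 0"
    and t: "t \<in> time_set td"
  shows "0 \<le> e t"
proof (cases td)
  case CT
  define R where "R = (\<Sum>i\<in>UNIV. \<Sum>j\<in>UNIV. \<bar>M$i$j\<bar>)"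
  have row_le_R: "(\<Sum>j\<in>UNIV. \<bar>M$i$j\<bar>) \<le> R" for i
    unfolding R_def by (rule member_le_sum) (auto intro: sum_nonneg)
  show ?thesis
  proof (rule nonneg_invariant_CT[of e "\<lambda>t. M *v e t + r t" R])
    show "(e has_vector_derivative M *v e s + r s) (at s within {0..})" if "0 \<le> s" for s
      using ev that CT by (simp add: evolves_def)
    fix s i c
    assume "0 \<le> s" "0 \<le> c" "\<forall>j. -c \<le> e s $ j" "e s $ i = -c"
    then have "- ((\<Sum>j\<in>UNIV. \<bar>M$i$j\<bar>) * c) \<le> (M *v e s) $ i"
      using M CT by (intro metzler_row_lower_bound) (simp_all add: positive_system_matrix_def)
    moreover have "- (R * c) \<le> - ((\<Sum>j\<in>UNIV. \<bar>M$i$j\<bar>) * c)"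
      using row_le_R[of i] \<open>0 \<le> c\<close> by (simp add: mult_right_mono)
    moreover have "0 \<le> r s $ i"
      using r[of s] \<open>0 \<le> s\<close> CT by (simp add: time_set_def less_eq_vec_def)
    ultimately show "- (R * c) \<le> (M *v e s + r s) $ i"
      by simp
  qed (use init t CT in \<open>simp_all add: time_set_def\<close>)
next
  case DT
  have "0 \<le> e (real k)" for k
  proof (induction k)
    case 0
    then show ?case using init by simp
  next
    case (Suc k)
    have "0 \<le> M *v e (real k)"
      using nonneg_matrix_mult_mono[OF _ Suc.IH, of M] M DT
      by (simp add: positive_system_matrix_def)
    moreover have "0 \<le> r (real k)"
      using r DT by (simp add: time_set_def)
    ultimately show ?case
      using ev DT by (simp add: evolves_def add.commute)
  qed
  then show ?thesis
    using t DT by (auto simp: time_set_def)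
qed

definition sym_block :: "real^'k^'k \<Rightarrow> real^'k^'k \<Rightarrow> real^('k + 'k)^('k + 'k)" where
  "sym_block U D = (\<chi> a b. case (a, b) of
      (Inl i, Inl j) \<Rightarrow> U$i$j | (Inl i, Inr j) \<Rightarrow> D$i$j
    | (Inr i, Inl j) \<Rightarrow> D$i$j | (Inr i, Inr j) \<Rightarrow> U$i$j)"

lemma sum_UNIV_sum_type:
  "(\<Sum>k\<in>(UNIV :: ('a::finite + 'b::finite) set). f k) = (\<Sum>i\<in>UNIV. f (Inl i)) + (\<Sum>j\<in>UNIV. f (Inr j))"
  by (simp flip: UNIV_Plus_UNIV add: sum.Plus comp_def)

lemma sym_block_mult_vcat:
  "sym_block U D *v vcat a b = vcat (U *v a + D *v b) (D *v a + U *v b)"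
  by (auto simp: vec_eq_iff sym_block_def vcat_def matrix_vector_mult_def sum_UNIV_sum_type
      split: sum.split)

lemma positive_system_matrix_sym_block:
  "positive_system_matrix td (sym_block (Qup td Q) (Qdown td Q))"
  by (cases td) (auto simp: positive_system_matrix_def metzler_def nonneg_matrix_def sym_block_def
      Qup_def Qdown_def mdiag_def mpos_def mneg_def mnd_def split: sum.split)

lemma Qup_minus_Qdown: "Qup td Q - Qdown td Q = Q"
  by (cases td) (simp_all add: Qup_def Qdown_def mneg_def mnd_def)

lemma observer_coordinates_update:
  fixes A :: "real^'n^'n" and B :: "real^'p^'n" and W :: "real^'w^'n"
    and C :: "real^'n^'l" and D :: "real^'p^'l" and V :: "real^'v^'l"
    and L :: "real^'l^'n" and P :: "real^'n^'m"
  assumes "P ** (A - L ** C) = Q ** P"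
  shows "P *v (A *v x + B *v u + W *v w) =
           Q *v (P *v x) + (P ** L) *v (C *v x + D *v u + V *v v) + (P ** (B - L ** D)) *v u
           + (P ** W) *v w - (P ** L ** V) *v v"
proof -
  have "(A - L ** C) *v x = A *v x - L *v (C *v x)"
    by (simp add: matrix_vector_mult_diff_rdistrib matrix_vector_mul_assoc)
  then have "P *v (A *v x) = P *v ((A - L ** C) *v x) + P *v (L *v (C *v x))"
    by (simp add: matrix_vector_mult_diff_distrib)
  also have "\<dots> = Q *v (P *v x) + (P ** L) *v (C *v x)"
    by (simp add: matrix_vector_mul_assoc matrix_mul_assoc assms)
  finally show ?thesis
    by (simp add: algebra_simps flip: matrix_vector_mul_assoc)
qed

theorem theorem2:
  fixes td :: time_domain
    and A :: "real^'n^'n" and B :: "real^'p^'n" and W :: "real^'w^'n"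
    and C :: "real^'n^'l" and D :: "real^'p^'l" and V :: "real^'v^'l"
    and L :: "real^'l^'n" and P :: "real^'n^'m" and Q :: "real^'m^'m"
    and x0_lo x0_hi :: "real^'n" and w_lo w_hi :: "real^'w" and v_lo v_hi :: "real^'v"
    and x :: "real \<Rightarrow> real^'n" and u :: "real \<Rightarrow> real^'p" and y :: "real \<Rightarrow> real^'l"
    and w :: "real \<Rightarrow> real^'w" and v :: "real \<Rightarrow> real^'v"
    and z_lo z_hi :: "real \<Rightarrow> real^'m"
  assumes det: "detectable td A C"
    and stab: "stable_mat td (A - L ** C)"
    and rankP: "rank P = CARD('n)"
    and PQ: "P ** (A - L ** C) = Q ** P"
    and contr: "contractive td Q"
    and x0: "x0_lo \<le> x 0" "x 0 \<le> x0_hi"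
    and wb: "\<forall>t\<in>time_set td. w_lo \<le> w t \<and> w t \<le> w_hi"
    and vb: "\<forall>t\<in>time_set td. v_lo \<le> v t \<and> v t \<le> v_hi"
    and sys: "evolves td x (\<lambda>t. A *v x t + B *v u t + W *v w t)"
    and outp: "\<forall>t\<in>time_set td. y t = C *v x t + D *v u t + V *v v t"
    and z0: "z_lo 0 \<le> P *v x 0" "P *v x 0 \<le> z_hi 0"
    and obs_lo: "evolves td z_lo (\<lambda>t. Qup td Q *v z_lo t - Qdown td Q *v z_hi t
                   + mpos (P ** W) *v w_lo - mneg (P ** W) *v w_hi
                   + mneg (P ** L ** V) *v v_lo - mpos (P ** L ** V) *v v_hi
                   + (P ** L) *v y t + (P ** (B - L ** D)) *v u t)"
    and obs_hi: "evolves td z_hi (\<lambda>t. Qup td Q *v z_hi t - Qdown td Q *v z_lo t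
                   + mpos (P ** W) *v w_hi - mneg (P ** W) *v w_lo
                   + mneg (P ** L ** V) *v v_hi - mpos (P ** L ** V) *v v_lo
                   + (P ** L) *v y t + (P ** (B - L ** D)) *v u t)"
  shows "\<forall>t\<in>time_set td.
           z_lo t \<le> P *v x t \<and> P *v x t \<le> z_hi t \<and>
           x t \<in> XP P C (z_lo t) (z_hi t) (c_lo C D V v_lo v_hi (y t) (u t)) (c_hi C D V v_lo v_hi (y t) (u t)) \<and>
           XP P C (z_lo t) (z_hi t) (c_lo C D V v_lo v_hi (y t) (u t)) (c_hi C D V v_lo v_hi (y t) (u t))
             \<subseteq> XI P C (z_lo t) (z_hi t) (c_lo C D V v_lo v_hi (y t) (u t)) (c_hi C D V v_lo v_hi (y t) (u t))"
proof -
  define e where "e t = vcat (P *v x t - z_lo t) (z_hi t - P *v x t)" for t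
  define r where "r t = vcat
      ((P ** W) *v w t - interval_lower (P ** W) w_lo w_hi
        + (interval_upper (P ** L ** V) v_lo v_hi - (P ** L ** V) *v v t))
      (interval_upper (P ** W) w_lo w_hi - (P ** W) *v w t
        + ((P ** L ** V) *v v t - interval_lower (P ** L ** V) v_lo v_hi))" for t
  have "evolves td e (\<lambda>t. sym_block (Qup td Q) (Qdown td Q) *v e t + r t)"
    using evolves_vcat[OF evolves_diff[OF evolves_matrix_mult[OF sys] obs_lo]
                          evolves_diff[OF obs_hi evolves_matrix_mult[OF sys]]]
    unfolding e_def
  proof (rule evolves_cong, goal_cases)
    case (1 t)
    have "P *v (A *v x t + B *v u t + W *v w t) =
           (Qup td Q - Qdown td Q) *v (P *v x t) + (P ** L) *v y t + (P ** (B - L ** D)) *v u t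
           + (P ** W) *v w t - (P ** L ** V) *v v t"
      using observer_coordinates_update[OF PQ] outp 1 by (simp add: Qup_minus_Qdown)
    then show ?case
      unfolding \<open>P *v (A *v x t + B *v u t + W *v w t) = _\<close>
      by (simp add: r_def sym_block_mult_vcat vcat_add interval_lower_def interval_upper_def
          algebra_simps)
  qed
  moreover have "0 \<le> r t" if "t \<in> time_set td" for t
    using that wb vb interval_gaps_nonneg[of w_lo "w t" w_hi "P ** W"]
      interval_gaps_nonneg[of v_lo "v t" v_hi "P ** L ** V"]
    by (simp add: r_def vcat_nonneg_iff)
  moreover have "0 \<le> e 0"
    using z0 by (simp add: e_def vcat_nonneg_iff)
  ultimately have e_nonneg: "0 \<le> e t" if "t \<in> time_set td" for t
    using positive_system_nonneg[OF positive_system_matrix_sym_block] that by blast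
  have "inj ((*v) P)"
    using rankP full_rank_injective by blast
  show ?thesis
  proof (intro ballI, goal_cases)
    case (1 t)
    have "z_lo t \<le> P *v x t" "P *v x t \<le> z_hi t"
      using e_nonneg[OF 1] by (simp_all add: e_def vcat_nonneg_iff)
    moreover have "c_lo C D V v_lo v_hi (y t) (u t) \<le> C *v x t"
      "C *v x t \<le> c_hi C D V v_lo v_hi (y t) (u t)"
      using measurement_bounds[of v_lo "v t" v_hi] vb outp 1 by auto
    ultimately show ?case
      using XP_subset_XI[OF \<open>inj ((*v) P)\<close>] by (simp add: XP_def)
  qed
qed

end
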